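(* Let $1\le k\le\frac{n+1}{2}$. Then for all $\nu_1,\dots,\nu_k\in\mathbb{N}_0$ there exists a $k$-dimensional $\sigma$-cyclic convolutional code in $\mathbb{F}[z]^n$ with Forney indices $\nu_1,\dots,\nu_k$.
   Context: Let $\mathbb{F}$ be a finite field with $q$ elements and $n\ge2$ a divisor of $q-1$. Let $A=\mathbb{F}\times\cdots\times\mathbb{F}$ ($n$ copies), elements $[a_1,\dots,a_n]$, and $\sigma([a_1,\dots,a_n])=[a_n,a_1,\dots,a_{n-1}]$. $A[z;\sigma]$ is the skew polynomial ring of polynomials $\sum_\nu z^\nu a_\nu$ ($a_\nu\in A$, right coefficients) with multiplication determined by $az=z\sigma(a)$ for $a\in A$. Fix an $\mathbb{F}$-algebra isomorphism $\phi:\mathbb{F}[x]/\langle x^n-1\rangle\to A$ and let $\mathfrak{p}:\mathbb{F}[z]^n\to A[z;\sigma]$, $\sum_\nu z^\nu v_\nu\mapsto\sum_\nu z^\nu\phi(\sum_{i=0}^{n-1}v_{\nu,i}x^i)$. A convolutional code of length $n$ and dimension $k$ is a submodule $\{uG\mid u\in\mathbb{F}[z]^k\}\subseteq\mathbb{F}[z]^n$ with $G\in\mathbb{F}[z]^{k\times n}$ basic (rank $k$ at every point of an algebraic closure of $\mathbb{F}$); $G$ is a minimal encoder if the sum of its row degrees equals the maximal degree of its $k\times k$ minors, and the row degrees of a minimal encoder (unique up to order) are the Forney indices of the code. A $\sigma$-cyclic convolutional code is a convolutional code $\mathcal{C}$ such that $\mathfrak{p}(\mathcal{C})$ is a left ideal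 of $A[z;\sigma]$. *)

theory Defs
  imports "HOL-Algebra.Algebraic_Closure_Type" "HOL-Combinatorics.Permutations"
begin

text \<open>The algebra A = F x ... x F (n copies): functions nat => F vanishing from index n on.
  Index i (0-based) corresponds to the paper's component a_(i+1).\<close>
definition Aset :: "nat \<Rightarrow> (nat \<Rightarrow> 'a::zero) set" where
  "Aset n = {a. \<forall>i\<ge>n. a i = 0}"

definition sigmaA :: "nat \<Rightarrow> (nat \<Rightarrow> 'a::zero) \<Rightarrow> nat \<Rightarrow> 'a" where
  "sigmaA n a i = (if i < n then a ((i + n - 1) mod n) else 0)"

text \<open>Skew polynomials sum_nu z^nu a_nu in A[z;sigma]: coefficient sequences nat => A
  with finite support.\<close>
definition skew_polys :: "nat \<Rightarrow> (nat \<Rightarrow> nat \<Rightarrow> 'a::zero) set" where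
  "skew_polys n = {f. (\<forall>\<nu>. f \<nu> \<in> Aset n) \<and> finite {\<nu>. f \<nu> \<noteq> (\<lambda>_. 0)}}"

text \<open>Multiplication determined by a z = z sigma(a):
  (z^i a)(z^j b) = z^(i+j) sigma^j(a) b.\<close>
definition skew_mult :: "nat \<Rightarrow> (nat \<Rightarrow> nat \<Rightarrow> 'a::comm_ring_1) \<Rightarrow> (nat \<Rightarrow> nat \<Rightarrow> 'a)
    \<Rightarrow> nat \<Rightarrow> nat \<Rightarrow> 'a" where
  "skew_mult n f g m i = (\<Sum>j\<le>m. ((sigmaA n ^^ j) (f (m - j))) i * g j i)"

definition skew_add :: "(nat \<Rightarrow> nat \<Rightarrow> 'a::plus) \<Rightarrow> (nat \<Rightarrow> nat \<Rightarrow> 'a) \<Rightarrow> nat \<Rightarrow> nat \<Rightarrow> 'a" where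
  "skew_add f g m i = f m i + g m i"

definition left_ideal :: "nat \<Rightarrow> (nat \<Rightarrow> nat \<Rightarrow> 'a::comm_ring_1) set \<Rightarrow> bool" where
  "left_ideal n I \<longleftrightarrow> I \<subseteq> skew_polys n \<and> (\<lambda>_ _. 0) \<in> I
     \<and> (\<forall>f\<in>I. \<forall>g\<in>I. skew_add f g \<in> I)
     \<and> (\<forall>r\<in>skew_polys n. \<forall>f\<in>I. skew_mult n r f \<in> I)"

text \<open>phi : F[x]/<x^n - 1> -> A an F-algebra isomorphism, represented as an
  F-algebra homomorphism F[x] -> A which is onto A and whose kernel is <x^n - 1>.\<close>
definition is_phi :: "nat \<Rightarrow> ('a::field poly \<Rightarrow> nat \<Rightarrow> 'a) \<Rightarrow> bool" where
  "is_phi n \<phi> \<longleftrightarrow>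
     (\<forall>p. \<phi> p \<in> Aset n)
   \<and> (\<forall>p q i. \<phi> (p + q) i = \<phi> p i + \<phi> q i)
   \<and> (\<forall>p q i. \<phi> (p * q) i = \<phi> p i * \<phi> q i)
   \<and> (\<forall>c p i. \<phi> (smult c p) i = c * \<phi> p i)
   \<and> \<phi> 1 = (\<lambda>i. if i < n then 1 else 0)
   \<and> (\<forall>p. \<phi> p = (\<lambda>_. 0) \<longleftrightarrow> (monom 1 n - 1) dvd p)
   \<and> \<phi> ` UNIV = Aset n"

text \<open>The map frak p : F[z]^n -> A[z;sigma]; vectors in F[z]^n are functions nat => F[z]
  (components 0..n-1).\<close>
definition frak_p :: "nat \<Rightarrow> ('a::field poly \<Rightarrow> nat \<Rightarrow> 'a) \<Rightarrow> (nat \<Rightarrow> 'a poly) \<Rightarrow> nat \<Rightarrow> nat \<Rightarrow> 'a" where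
  "frak_p n \<phi> v \<nu> = \<phi> (\<Sum>i<n. monom (coeff (v i) \<nu>) i)"

definition code :: "nat \<Rightarrow> nat \<Rightarrow> (nat \<Rightarrow> nat \<Rightarrow> 'a::comm_ring_1 poly) \<Rightarrow> (nat \<Rightarrow> 'a poly) set" where
  "code n k G = {(\<lambda>j. if j < n then (\<Sum>i<k. u i * G i j) else 0) | u. True}"

definition basic :: "nat \<Rightarrow> nat \<Rightarrow> (nat \<Rightarrow> nat \<Rightarrow> 'a::field poly) \<Rightarrow> bool" where
  "basic n k G \<longleftrightarrow> (\<forall>(t::'a alg_closure) (c::nat \<Rightarrow> 'a alg_closure).
      (\<forall>j<n. (\<Sum>i<k. c i * poly (map_poly to_ac (G i j)) t) = 0) \<longrightarrow> (\<forall>i<k. c i = 0))"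

definition detk :: "nat \<Rightarrow> (nat \<Rightarrow> nat \<Rightarrow> 'a::comm_ring_1) \<Rightarrow> 'a" where
  "detk k M = (\<Sum>p | p permutes {..<k}. of_int (sign p) * (\<Prod>i<k. M i (p i)))"

definition row_degree :: "nat \<Rightarrow> (nat \<Rightarrow> nat \<Rightarrow> 'a::zero poly) \<Rightarrow> nat \<Rightarrow> nat" where
  "row_degree n G i = Max {degree (G i j) | j. j < n}"

definition max_minor_degree :: "nat \<Rightarrow> nat \<Rightarrow> (nat \<Rightarrow> nat \<Rightarrow> 'a::comm_ring_1 poly) \<Rightarrow> nat" where
  "max_minor_degree n k G = Max {degree (detk k (\<lambda>i j. G i (s j))) | s.
       strict_mono_on {..<k} s \<and> s ` {..<k} \<subseteq> {..<n}}"

definition minimal_encoder :: "nat \<Rightarrow> nat \<Rightarrow> (nat \<Rightarrow> nat \<Rightarrow> 'a::comm_ring_1 poly) \<Rightarrow> bool" where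
  "minimal_encoder n k G \<longleftrightarrow> (\<Sum>i<k. row_degree n G i) = max_minor_degree n k G"

definition sigma_cyclic :: "nat \<Rightarrow> ('a::field poly \<Rightarrow> nat \<Rightarrow> 'a) \<Rightarrow> (nat \<Rightarrow> 'a poly) set \<Rightarrow> bool" where
  "sigma_cyclic n \<phi> C \<longleftrightarrow> left_ideal n (frak_p n \<phi> ` C)"

end

theory Submission
  imports Defs "Jordan_Normal_Form.Determinant" "HOL-Library.Infinite_Set"
begin

text \<open>
  In the coordinates of \<open>A\<close> given by \<open>\<phi>\<close>, a code is \<open>\<sigma>\<close>-cyclic as soon as it is spanned by
  homogeneous rows: \<open>z\<^sup>m\<close> occurs in row \<open>r\<close> only at position \<open>x r + m\<close> modulo \<open>n\<close>. A row of degree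
  \<open>\<nu> r\<close> then has its leading coefficient at the single position \<open>x r + \<nu> r\<close>. As \<open>2k \<le> n + 1\<close>, the
  \<open>x r\<close> can be chosen greedily such that both the \<open>x r\<close> and the \<open>x r + \<nu> r\<close> are distinct modulo \<open>n\<close>,
  which takes care of minimality and of the rank at \<open>z = 0\<close>.

  The rows \<open>\<epsilon>(x r) + z\<^sup>\<nu> \<epsilon>(x r + \<nu> r)\<close> are already basic when the partial injection
  \<open>x r \<mapsto> x r + \<nu> r\<close> of the circle has no cycles. Rotate so that position \<open>n - 1\<close> is no \<open>x r\<close>, and in every
  cycle take the row with the largest \<open>x r\<close>: its arc wraps around, so a term at any position above
  \<open>x r\<close> has degree below \<open>\<nu> r\<close>. Linking it to the next larger such position, or to \<open>n - 1\<close> for the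
  last one, makes the columns at the link targets kill the coefficients of the cycles one after
  another, starting with the highest cycle.
\<close>

section \<open>Choosing start positions on the circle\<close>

lemma add_mod_cancel:
  fixes i j d n :: nat
  assumes "(i + d) mod n = (j + d) mod n" "i < n" "j < n"
  shows "i = j"
proof -
  have le: "i = j" if "i \<le> j" "(j + d) mod n = (i + d) mod n" "j < n" for i j :: nat
  proof -
    have "n dvd j - i" using that mod_eq_dvd_iff_nat[of "i + d" "j + d" n] by simp
    moreover have "j - i < n" using that by simp
    ultimately have "j - i = 0" by (metis dvd_imp_le gr_zeroI not_le)
    with that show ?thesis by simp
  qed
  show ?thesis
  proof (cases "i \<le> j")
    case True
    then show ?thesis using le[of i j] assms by simp
  next
    case False
    then show ?thesis using le[of j i] assms by simp
  qed
qed

text \<open>Greedy choice: for row \<open>k\<close>, at most \<open>k\<close> positions are already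
  starts and, shifts being injective modulo \<open>n\<close>, at most \<open>k\<close> positions
  (the set \<open>V\<close>) lead to an end that is already taken. The bound for
  \<open>Suc k\<close> gives \<open>2 * k < n\<close>, so a position remains.\<close>

lemma exists_distinct_shifts:
  fixes \<nu> :: "nat \<Rightarrow> nat"
  assumes "n > 0" and "2 * k \<le> n + 1"
  shows "\<exists>x. (\<forall>r<k. x r < n) \<and> inj_on x {..<k} \<and> inj_on (\<lambda>r. (x r + \<nu> r) mod n) {..<k}"
  using assms(2)
proof (induction k)
  case 0
  then show ?case by simp
next
  case (Suc k)
  then obtain x where x: "\<forall>r<k. x r < n" "inj_on x {..<k}"
      "inj_on (\<lambda>r. (x r + \<nu> r) mod n) {..<k}"
    by auto
  let ?y = "\<lambda>r. (x r + \<nu> r) mod n"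
  let ?h = "\<lambda>i. (i + \<nu> k) mod n"
  define V where "V = {i\<in>{..<n}. ?h i \<in> ?y ` {..<k}}"
  have inj: "inj_on ?h {..<n}" by (meson add_mod_cancel inj_onI lessThan_iff)
  have "card V = card (?h ` V)"
    by (intro card_image[symmetric] inj_on_subset[OF inj]) (auto simp: V_def)
  also have "\<dots> \<le> card (?y ` {..<k})"
    by (intro card_mono) (auto simp: V_def)
  also have "\<dots> \<le> k" using card_image_le[of "{..<k}" ?y] by simp
  finally have "card (x ` {..<k} \<union> V) \<le> 2 * k"
    using card_image_le[of "{..<k}" x] card_Un_le[of "x ` {..<k}" V] by simp
  also have "2 * k < card {..<n}" using Suc.prems by simp
  finally have "\<not> {..<n} \<subseteq> x ` {..<k} \<union> V"
    using card_mono[of "x ` {..<k} \<union> V" "{..<n}"] by (auto simp: V_def)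
  then obtain i where i: "i < n" "i \<notin> x ` {..<k}" "?h i \<notin> ?y ` {..<k}"
    by (auto simp: V_def)
  define x' where "x' = x(k := i)"
  have x'k: "x' k = i" and x': "\<And>r. r < k \<Longrightarrow> x' r = x r" by (auto simp: x'_def)
  have inj_Suc: "inj_on g {..<Suc k}" if "inj_on h {..<k}" "\<And>r. r < k \<Longrightarrow> g r = h r" "g k \<notin> h ` {..<k}"
    for g h :: "nat \<Rightarrow> nat"
  proof -
    have "inj_on g {..<k}" using that(1,2) by (metis inj_on_cong lessThan_iff)
    moreover have "g ` {..<k} = h ` {..<k}" using that(2) by (auto simp: image_iff)
    ultimately show ?thesis using that(3) by (simp add: lessThan_Suc)
  qed
  have "inj_on x' {..<Suc k}"
    by (rule inj_Suc[of x]) (use x i x'k x' in auto)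
  moreover have "inj_on (\<lambda>r. (x' r + \<nu> r) mod n) {..<Suc k}"
    by (rule inj_Suc[of ?y]) (use x i x'k x' in simp_all)
  moreover have "\<forall>r<Suc k. x' r < n" using x(1) i(1) by (auto simp: less_Suc_eq x'k x')
  ultimately show ?case by blast
qed

text \<open>Rotating all positions by the same \<open>d\<close> keeps starts and ends distinct. As
  \<open>k < n\<close>, some position \<open>f\<close> is not a start, and \<open>d\<close> is
  chosen to move it to \<open>n - 1\<close>.\<close>

lemma exists_distinct_shifts_avoiding_last:
  fixes \<nu> :: "nat \<Rightarrow> nat"
  assumes "k < n" and "2 * k \<le> n + 1"
  shows "\<exists>x. (\<forall>r<k. x r < n - 1) \<and> inj_on x {..<k} \<and> inj_on (\<lambda>r. (x r + \<nu> r) mod n) {..<k}"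
proof -
  have n: "n > 0" using assms by simp
  obtain x where x: "\<forall>r<k. x r < n" "inj_on x {..<k}"
      "inj_on (\<lambda>r. (x r + \<nu> r) mod n) {..<k}"
    using exists_distinct_shifts[OF n assms(2)] by blast
  have "card (x ` {..<k}) < card {..<n}"
    using card_image_le[of "{..<k}" x] assms(1) by simp
  then have "\<not> {..<n} \<subseteq> x ` {..<k}"
    using card_mono[of "x ` {..<k}" "{..<n}"] by auto
  then obtain f where f: "f < n" "f \<notin> x ` {..<k}" by auto
  define d where "d = n - 1 - f"
  define x' where "x' = (\<lambda>r. (x r + d) mod n)"
  have "x' r < n - 1" if "r < k" for r
  proof -
    have "(f + d) mod n = n - 1" using f n by (simp add: d_def)
    moreover have "x r \<noteq> f" using f that by auto
    ultimately have "x' r \<noteq> n - 1" using add_mod_cancel[of "x r" d n f] x(1) f that by (auto simp: x'_def)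
    moreover have "x' r < n" using n by (simp add: x'_def)
    ultimately show ?thesis by simp
  qed
  moreover have "inj_on x' {..<k}"
  proof (rule inj_onI)
    fix r s assume rs: "r \<in> {..<k}" "s \<in> {..<k}" and "x' r = x' s"
    then have "(x r + d) mod n = (x s + d) mod n" by (simp only: x'_def)
    moreover have "x r < n" "x s < n" using x(1) rs by auto
    ultimately have "x r = x s" by (rule add_mod_cancel)
    with x(2) rs show "r = s" by (simp add: inj_on_eq_iff)
  qed
  moreover have "inj_on (\<lambda>r. (x' r + \<nu> r) mod n) {..<k}"
  proof -
    have eq: "(x' r + \<nu> r) mod n = ((x r + \<nu> r) mod n + d) mod n" for r
      by (simp only: x'_def mod_add_left_eq add.assoc add.commute[of d])
    show ?thesis
      unfolding eq
    proof (rule inj_onI)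
      fix r s assume rs: "r \<in> {..<k}" "s \<in> {..<k}"
        and h: "((x r + \<nu> r) mod n + d) mod n = ((x s + \<nu> s) mod n + d) mod n"
      have "(x r + \<nu> r) mod n = (x s + \<nu> s) mod n"
        by (rule add_mod_cancel[OF h]) (use n in simp_all)
      then show "r = s" by (rule inj_onD[OF x(3) _ rs])
    qed
  qed
  ultimately show ?thesis by blast
qed

section \<open>Cycles of the partial injection and their links\<close>

locale shift_pattern =
  fixes n k :: nat and x \<nu> :: "nat \<Rightarrow> nat"
  assumes x_less: "r < k \<Longrightarrow> x r < n - 1"
    and inj_x: "inj_on x {..<k}"
    and inj_end_pos: "inj_on (\<lambda>r. (x r + \<nu> r) mod n) {..<k}"
begin

definition end_pos :: "nat \<Rightarrow> nat" where "end_pos r = (x r + \<nu> r) mod n"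

text \<open>Demanding \<open>\<nu> r > 0\<close> keeps a constant row, which ends where it starts,
  from counting as a cycle.\<close>

definition follows :: "nat \<Rightarrow> nat \<Rightarrow> bool" where
  "follows r s \<longleftrightarrow> r < k \<and> s < k \<and> \<nu> r > 0 \<and> end_pos r = x s"

text \<open>Closure under predecessors matches the linear algebra: by \<open>pred_nonzero\<close>, a
  nonzero coefficient outside \<open>tops\<close> forces one at the preceding row.\<close>

definition closed_pred :: "nat set \<Rightarrow> bool" where
  "closed_pred D \<longleftrightarrow> D \<subseteq> {..<k} \<and> (\<forall>s\<in>D. \<exists>r\<in>D. follows r s)"

text \<open>\<open>follows\<close> is a partial injection; \<open>cyclic\<close> is the union of its cycles, and
  \<open>tops\<close> picks the row with the largest \<open>x\<close> from every cycle.\<close>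
definition cyclic :: "nat set" where "cyclic = \<Union> {D. closed_pred D}"

definition tops :: "nat set" where "tops = {a \<in> cyclic. \<forall>b. follows\<^sup>*\<^sup>* a b \<longrightarrow> x b \<le> x a}"

text \<open>Since \<open>n - 1\<close> is never a start, it can serve as the target for the highest
  row of \<open>tops\<close>.\<close>

definition link :: "nat \<Rightarrow> nat" where
  "link a = Min (insert (n - 1) {x b | b. b \<in> tops \<and> x b > x a})"

lemma follows_succ_unique: "follows r s \<Longrightarrow> follows r s' \<Longrightarrow> s = s'"
  using inj_x by (auto simp: follows_def inj_on_def)

lemma follows_pred_unique: "follows r s \<Longrightarrow> follows r' s \<Longrightarrow> r = r'"
  using inj_end_pos by (auto simp: follows_def inj_on_def end_pos_def)

lemma closed_pred_finite: "closed_pred D \<Longrightarrow> finite D"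
  by (auto simp: closed_pred_def intro: finite_subset)

text \<open>Choosing predecessors maps the finite set \<open>D\<close> injectively into itself,
  because successors are unique. The map is therefore onto, so each element of \<open>D\<close>
  precedes another.\<close>

lemma closed_pred_succ:
  assumes "closed_pred D" "r \<in> D"
  shows "\<exists>s\<in>D. follows r s"
proof -
  have "\<exists>p. \<forall>s\<in>D. p s \<in> D \<and> follows (p s) s"
    using assms(1) by (intro bchoice) (auto simp: closed_pred_def)
  then obtain p where p: "\<And>s. s \<in> D \<Longrightarrow> p s \<in> D \<and> follows (p s) s" by blast
  then have "inj_on p D" by (metis inj_onI follows_succ_unique)
  moreover have "p ` D \<subseteq> D" using p by auto
  ultimately have "p ` D = D" using closed_pred_finite[OF assms(1)] by (metis endo_inj_surj)
  with assms(2) p show ?thesis by (metis imageE)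
qed

lemma closed_pred_rtranclp:
  assumes "closed_pred D" "follows\<^sup>*\<^sup>* a b" "a \<in> D"
  shows "b \<in> D"
  using assms(2,3)
proof (induction rule: rtranclp_induct)
  case (step b c)
  then show ?case using closed_pred_succ[OF assms(1)] follows_succ_unique by blast
qed

lemma closed_cyclic: "closed_pred cyclic"
  unfolding closed_pred_def cyclic_def by blast

lemma closed_subset_cyclic: "closed_pred D \<Longrightarrow> D \<subseteq> cyclic"
  unfolding cyclic_def by blast

lemma cyclic_less: "a \<in> cyclic \<Longrightarrow> a < k"
  using closed_cyclic by (auto simp: closed_pred_def)

lemma tops_less: "a \<in> tops \<Longrightarrow> a < k"
  by (simp add: tops_def cyclic_less)

text \<open>Every row of \<open>cyclic\<close> has a successor, and taking successors maps the
  finite orbit injectively into itself. Surjectivity supplies the predecessors.\<close>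

lemma closed_orbit:
  assumes "a \<in> cyclic"
  shows "closed_pred {b. follows\<^sup>*\<^sup>* a b}"
proof -
  let ?O = "{b. follows\<^sup>*\<^sup>* a b}"
  have sub: "?O \<subseteq> cyclic" using closed_pred_rtranclp[OF closed_cyclic] assms by blast
  then have fin: "finite ?O" using closed_pred_finite[OF closed_cyclic] finite_subset by blast
  have "\<exists>f. \<forall>s\<in>?O. follows s (f s)"
    using closed_pred_succ[OF closed_cyclic] sub by (intro bchoice) blast
  then obtain f where f: "\<And>s. s \<in> ?O \<Longrightarrow> follows s (f s)" by blast
  then have "inj_on f ?O" by (metis inj_onI follows_pred_unique)
  moreover have "f ` ?O \<subseteq> ?O" using f by (auto intro: rtranclp.rtrancl_into_rtrancl)
  ultimately have "f ` ?O = ?O" using fin by (metis endo_inj_surj)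
  then have "\<forall>s\<in>?O. \<exists>r\<in>?O. follows r s" using f by (metis imageE)
  moreover have "?O \<subseteq> {..<k}" using sub closed_cyclic by (auto simp: closed_pred_def)
  ultimately show ?thesis by (simp add: closed_pred_def)
qed

lemma orbit_pred:
  assumes "a \<in> cyclic" "follows\<^sup>*\<^sup>* a s" "follows r s"
  shows "follows\<^sup>*\<^sup>* a r"
proof -
  obtain r' where "follows\<^sup>*\<^sup>* a r'" "follows r' s"
    using closed_orbit[OF assms(1)] assms(2) by (auto simp: closed_pred_def)
  then show ?thesis using follows_pred_unique assms(3) by blast
qed

lemma orbit_sym:
  assumes "a \<in> cyclic" "follows\<^sup>*\<^sup>* a b"
  shows "follows\<^sup>*\<^sup>* b a"
proof -
  have "b \<in> cyclic" using closed_pred_rtranclp[OF closed_cyclic] assms by blast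
  show ?thesis using assms(2)
  proof (induction rule: converse_rtranclp_induct)
    case (step c d)
    then show ?case using orbit_pred \<open>b \<in> cyclic\<close> by blast
  qed simp
qed

lemma tops_representative:
  assumes "s \<in> cyclic"
  obtains a where "a \<in> tops" "follows\<^sup>*\<^sup>* a s"
proof -
  let ?O = "{b. follows\<^sup>*\<^sup>* s b}"
  have fin: "finite ?O" by (rule closed_pred_finite[OF closed_orbit[OF assms]])
  moreover have "?O \<noteq> {}" by blast
  ultimately obtain a where a: "a \<in> ?O" "Max (x ` ?O) = x a" by (rule obtains_MAX)
  then have a: "follows\<^sup>*\<^sup>* s a" "\<And>b. follows\<^sup>*\<^sup>* s b \<Longrightarrow> x b \<le> x a"
    using Max_ge[of "x ` ?O"] fin by auto
  have "a \<in> cyclic" using closed_pred_rtranclp[OF closed_cyclic] assms a by blast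
  then have "a \<in> tops" using a by (auto simp: tops_def intro: rtranclp_trans)
  with orbit_sym[OF assms a(1)] that show ?thesis by blast
qed

lemma tops_unique:
  assumes "a \<in> tops" "b \<in> tops" "follows\<^sup>*\<^sup>* a b"
  shows "a = b"
proof -
  have "follows\<^sup>*\<^sup>* b a" using orbit_sym assms by (auto simp: tops_def)
  then have "x a = x b" using assms by (auto simp: tops_def intro: antisym)
  then show ?thesis using inj_x assms tops_less by (auto simp: inj_on_def)
qed

lemma finite_above: "finite {x b | b. b \<in> tops \<and> x b > x a}"
  by (rule finite_subset[of _ "x ` {..<k}"]) (auto simp: tops_less)

lemma link_cases:
  obtains "link a = n - 1" | b where "b \<in> tops" "x b > x a" "link a = x b"
proof -
  have "link a \<in> insert (n - 1) {x b | b. b \<in> tops \<and> x b > x a}"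
    unfolding link_def by (rule Min_in) (simp_all add: finite_above)
  then show ?thesis using that by blast
qed

lemma link_le: "link a \<le> n - 1"
  unfolding link_def by (rule Min_le) (simp_all add: finite_above)

lemma link_le_x: "b \<in> tops \<Longrightarrow> x b > x a \<Longrightarrow> link a \<le> x b"
  unfolding link_def using finite_above by (intro Min_le) auto

lemma x_less_link: "a < k \<Longrightarrow> x a < link a"
  using x_less by (cases a rule: link_cases) auto

text \<open>If \<open>x r < x a\<close>, then \<open>link r\<close> is at most \<open>x a\<close>,
  which lies below \<open>link a\<close>.\<close>

lemma link_inj: "r \<in> tops \<Longrightarrow> a \<in> tops \<Longrightarrow> link r = link a \<Longrightarrow> r = a"
proof -
  assume as: "r \<in> tops" "a \<in> tops" "link r = link a"
  have "\<not> x r < x a" "\<not> x a < x r"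
    using link_le_x[of a r] link_le_x[of r a] x_less_link[of a] x_less_link[of r] as tops_less by fastforce+
  then show ?thesis using inj_x as tops_less by (auto simp: inj_on_def)
qed

lemma tops_succ:
  assumes "a \<in> tops"
  shows "\<nu> a > 0" "end_pos a \<le> x a"
proof -
  obtain s where s: "follows a s" using closed_pred_succ[OF closed_cyclic] assms by (auto simp: tops_def)
  then show "\<nu> a > 0" by (simp add: follows_def)
  have "x s \<le> x a" using assms s by (auto simp: tops_def)
  then show "end_pos a \<le> x a" using s by (simp add: follows_def)
qed

text \<open>The arc of a row of \<open>tops\<close> wraps around the circle, since it ends weakly before its start.\<close>
lemma link_less:
  assumes "a \<in> tops"
  shows "link a - x a < \<nu> a"
proof -
  have "x a + \<nu> a \<ge> n"
  proof (rule ccontr)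
    assume "\<not> ?thesis"
    then have "end_pos a = x a + \<nu> a" by (simp add: end_pos_def)
    with tops_succ[OF assms] show False by simp
  qed
  moreover have "link a < n" using link_le[of a] x_less tops_less[OF assms] by fastforce
  ultimately show ?thesis using x_less_link tops_less[OF assms] by fastforce
qed

text \<open>One formula yields both the polynomial row, with the variable for \<open>t\<close>, and
  its value at a point of the algebraic closure. The guard \<open>\<nu> r > 0\<close> avoids
  counting the term of a constant row twice.\<close>

definition entry :: "'b::comm_semiring_1 \<Rightarrow> nat \<Rightarrow> nat \<Rightarrow> 'b" where
  "entry t r j = (if j = x r then 1 else 0)
     + (if \<nu> r > 0 \<and> j = end_pos r then t ^ \<nu> r else 0)
     + (if r \<in> tops \<and> j = link r then t ^ (link r - x r) else 0)"

section \<open>Linear independence of the rows at every point\<close>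

context
  fixes t :: "'b::field" and c :: "nat \<Rightarrow> 'b"
  assumes col: "j < n \<Longrightarrow> (\<Sum>r<k. c r * entry t r j) = 0"
begin

text \<open>In column \<open>x s\<close> only row \<open>s\<close> has its start, and no link ends
  there, since links end at \<open>n - 1\<close> or at starts of \<open>tops\<close>. Hence
  \<open>c s\<close> can cancel only against a row whose end is \<open>x s\<close>.\<close>

lemma pred_nonzero:
  assumes "s < k" "c s \<noteq> 0" "s \<notin> tops"
  shows "\<exists>r. follows r s \<and> c r \<noteq> 0"
proof (rule ccontr)
  assume no: "\<not> ?thesis"
  have "c r * entry t r (x s) = (if r = s then c s else 0)" if r: "r < k" for r
  proof -
    have "x s = x r \<longleftrightarrow> r = s" using inj_x assms r by (auto simp: inj_on_def)
    moreover have "x s \<noteq> link r"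
    proof (cases r rule: link_cases)
      case 1
      with x_less[OF assms(1)] show ?thesis by simp
    next
      case (2 b)
      then show ?thesis using inj_x assms tops_less[of b] by (auto simp: inj_on_def)
    qed
    moreover have "c r = 0" if "\<nu> r > 0" "x s = end_pos r" using no that r assms by (auto simp: follows_def)
    ultimately show ?thesis by (auto simp: entry_def)
  qed
  then have "(\<Sum>r<k. c r * entry t r (x s)) = c s" using assms by simp
  moreover have "x s < n" using x_less[OF assms(1)] by simp
  ultimately show False using col assms by simp
qed

text \<open>Successors of cyclic rows are cyclic, so predecessors of noncyclic rows are noncyclic.
  The noncyclic rows with nonzero coefficient are thus closed under predecessors and would lie in
  \<open>cyclic\<close>.\<close>

lemma nonzero_in_cyclic:
  assumes "s < k" "c s \<noteq> 0"
  shows "s \<in> cyclic"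
proof (rule ccontr)
  assume "s \<notin> cyclic"
  let ?D = "{s. s < k \<and> c s \<noteq> 0 \<and> s \<notin> cyclic}"
  have "closed_pred ?D"
    unfolding closed_pred_def
  proof (intro conjI ballI)
    fix s assume s: "s \<in> ?D"
    then obtain r where r: "follows r s" "c r \<noteq> 0" using pred_nonzero[of s] by (auto simp: tops_def)
    moreover have "r \<notin> cyclic" using closed_pred_rtranclp[OF closed_cyclic] s r by blast
    ultimately show "\<exists>r\<in>?D. follows r s" by (auto simp: follows_def)
  qed auto
  from closed_subset_cyclic[OF this] \<open>s \<notin> cyclic\<close> assms show False by blast
qed

text \<open>As \<open>a\<close> is the only member of \<open>tops\<close> in its orbit,
  \<open>pred_nonzero\<close> applies to all rows of the orbit with nonzero coefficient. These would
  be closed under predecessors, hence under successors, and so reach \<open>a\<close>.\<close>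

lemma orbit_zero:
  assumes "a \<in> tops" "c a = 0" "follows\<^sup>*\<^sup>* a b"
  shows "c b = 0"
proof (rule ccontr)
  assume "c b \<noteq> 0"
  have aK: "a \<in> cyclic" using assms by (simp add: tops_def)
  have cl: "closed_pred {b. follows\<^sup>*\<^sup>* a b}" by (rule closed_orbit[OF aK])
  let ?D = "{b. follows\<^sup>*\<^sup>* a b \<and> c b \<noteq> 0}"
  have "closed_pred ?D"
    unfolding closed_pred_def
  proof (intro conjI ballI)
    show "?D \<subseteq> {..<k}" using cl by (auto simp: closed_pred_def)
    fix s assume s: "s \<in> ?D"
    then have "s < k" using cl by (auto simp: closed_pred_def)
    moreover have "s \<notin> tops" using tops_unique[of a s] s assms by auto
    ultimately obtain r where r: "follows r s" "c r \<noteq> 0" using pred_nonzero s by blast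
    then have "follows\<^sup>*\<^sup>* a r" using orbit_pred[OF aK] s by blast
    with r show "\<exists>r\<in>?D. follows r s" by blast
  qed
  then have "a \<in> ?D"
    using closed_pred_rtranclp[of ?D b a] orbit_sym[OF aK assms(3)] assms \<open>c b \<noteq> 0\<close> by blast
  then show False using assms by simp
qed

lemma tops_zero:
  assumes "t \<noteq> 0" "a \<in> tops"
  shows "c a = 0"
proof (rule ccontr)
  assume "c a \<noteq> 0"
  \<comment> \<open>Take the highest offending row of \<open>tops\<close>; in the column of its
    link, all other contributions vanish.\<close>
  define W where "W = {a \<in> tops. c a \<noteq> 0}"
  have "finite W" by (rule finite_subset[of _ "{..<k}"]) (auto simp: W_def tops_less)
  moreover have "W \<noteq> {}" using assms \<open>c a \<noteq> 0\<close> by (auto simp: W_def)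
  ultimately obtain a where "a \<in> W" and mx: "Max (x ` W) = x a" by (rule obtains_MAX)
  then have a: "a \<in> tops" "c a \<noteq> 0" by (auto simp: W_def)
  have mx: "c b = 0" if "b \<in> tops" "x b > x a" for b
  proof (rule ccontr)
    assume "c b \<noteq> 0"
    then have "x b \<le> Max (x ` W)" using \<open>finite W\<close> that by (intro Max_ge) (auto simp: W_def)
    with mx that show False by simp
  qed
  have ak: "a < k" using a tops_less by simp
  \<comment> \<open>If the link goes to \<open>n - 1\<close>, no row starts there, and a row with
    nonzero coefficient lies on a cycle and so ends at a start. Otherwise it goes to the start of a
    higher \<open>b\<close>, whose whole orbit has zero coefficients.\<close>
  have others: "c r = 0" if r: "r < k" "x r = link a \<or> (\<nu> r > 0 \<and> end_pos r = link a)" for r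
  proof (cases a rule: link_cases)
    case 1
    show ?thesis
    proof (rule ccontr)
      assume "c r \<noteq> 0"
      then obtain s where "follows r s" using r(1) nonzero_in_cyclic closed_pred_succ[OF closed_cyclic] by blast
      then have "end_pos r < n - 1" using x_less by (auto simp: follows_def)
      with 1 r x_less[OF r(1)] show False by simp
    qed
  next
    case (2 b)
    then have cb: "c b = 0" using mx by simp
    have bk: "b < k" and bK: "b \<in> cyclic" using 2 by (auto simp: tops_less tops_def)
    from r(2) show ?thesis
    proof
      assume "x r = link a"
      then have "r = b" using 2 r bk inj_x by (auto simp: inj_on_def)
      with cb show ?thesis by simp
    next
      assume "\<nu> r > 0 \<and> end_pos r = link a"
      then have "follows r b" using 2 r bk by (simp add: follows_def)
      then have "follows\<^sup>*\<^sup>* b r" using orbit_pred[OF bK] by blast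
      with cb 2 show ?thesis using orbit_zero by blast
    qed
  qed
  have "c r * entry t r (link a) = (if r = a then c a * t ^ (link a - x a) else 0)" if r: "r < k" for r
  proof (cases "c r = 0")
    case True
    with a show ?thesis by (metis mult_zero_left)
  next
    case False
    then have "(link a = x r) = False" "(\<nu> r > 0 \<and> link a = end_pos r) = False" using others[OF r] by metis+
    moreover have "(r \<in> tops \<and> link a = link r) = (r = a)" using link_inj a(1) by metis
    ultimately have "entry t r (link a) = 0 + 0 + (if r = a then t ^ (link r - x r) else 0)"
      by (simp only: entry_def if_False)
    then show ?thesis by simp
  qed
  then have "(\<Sum>r<k. c r * entry t r (link a)) = c a * t ^ (link a - x a)" using ak by simp
  moreover have "link a < n" using link_le[of a] x_less[OF ak] by simp
  ultimately show False using col a assms by simp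
qed

lemma independent_rows:
  assumes "s < k"
  shows "c s = 0"
proof (cases "t = 0")
  \<comment> \<open>At \<open>t = 0\<close> all terms of positive degree vanish, links included, and
    distinct unit vectors remain.\<close>
  case True
  have "c r * entry t r (x s) = (if r = s then c s else 0)" if r: "r < k" for r
  proof -
    have "x s = x r \<longleftrightarrow> r = s" using inj_x assms r by (auto simp: inj_on_def)
    moreover have "t ^ (link r - x r) = 0" using True x_less_link[OF r] by simp
    ultimately have "entry t r (x s) = (if r = s then 1 else 0)"
      using True by (simp add: entry_def power_0_left)
    then show ?thesis by simp
  qed
  then have "(\<Sum>r<k. c r * entry t r (x s)) = c s" using assms by simp
  moreover have "x s < n" using x_less[OF assms(1)] by simp
  ultimately show ?thesis using col by simp
next
  case False
  show ?thesis
  proof (rule ccontr)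
    assume "c s \<noteq> 0"
    then obtain a where "a \<in> tops" "follows\<^sup>*\<^sup>* a s" using nonzero_in_cyclic tops_representative assms by blast
    then show False using tops_zero[OF False] orbit_zero \<open>c s \<noteq> 0\<close> by blast
  qed
qed

end

end

section \<open>Determinants and nonzero maximal minors\<close>

lemma detk_eq_det: "detk k M = det (mat k k (\<lambda>(i, j). M i j))"
proof -
  have "(\<Prod>i<k. M i (p i)) = (\<Prod>i = 0..<k. mat k k (\<lambda>(i, j). M i j) $$ (i, p i))"
    if "p permutes {..<k}" for p
  proof (rule prod.cong)
    fix i assume "i \<in> {0..<k}"
    moreover from this have "p i < k" using permutes_in_image[OF that, of i] by simp
    ultimately show "M i (p i) = mat k k (\<lambda>(i, j). M i j) $$ (i, p i)" by simp
  qed auto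
  then show ?thesis
    unfolding detk_def det_def by (auto simp: atLeast0LessThan intro!: sum.cong)
qed

lemma detk_transpose: "detk k (\<lambda>i j. M j i) = detk k M"
proof -
  have "transpose_mat (mat k k (\<lambda>(i, j). M i j)) = mat k k (\<lambda>(i, j). M j i)" by auto
  then show ?thesis
    using det_transpose[of "mat k k (\<lambda>(i, j). M i j)" k] by (simp add: detk_eq_det)
qed

lemma detk_permute_rows:
  assumes "p permutes {..<k}"
  shows "detk k (\<lambda>i. M (p i)) = of_int (sign p) * detk k M"
proof -
  have "mat k k (\<lambda>(i, j). mat k k (\<lambda>(i, j). M i j) $$ (p i, j)) = mat k k (\<lambda>(i, j). M (p i) j)"
    using permutes_in_image[OF assms] by (intro eq_matI) auto
  then show ?thesis
    using det_permute_rows[of "mat k k (\<lambda>(i, j). M i j)" k p] assms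
    by (simp add: detk_eq_det atLeast0LessThan)
qed

lemma detk_identical_rows:
  assumes "i < k" "j < k" "i \<noteq> j" "M i = M j"
  shows "detk k M = 0"
  unfolding detk_eq_det
  by (rule det_identical_rows[of _ k i j]) (use assms in \<open>auto intro!: eq_vecI\<close>)

text \<open>A weak form of Cauchy-Binet: expanding multilinearly in the rows, some summand must be
  nonzero.\<close>

lemma detk_rows_sum_nonzero:
  fixes c :: "nat \<Rightarrow> nat \<Rightarrow> 'b::comm_ring_1"
  assumes "detk k (\<lambda>s r. \<Sum>i<n. c s i * M i r) \<noteq> 0"
  shows "\<exists>f. (\<forall>s<k. f s < n) \<and> detk k (\<lambda>s. M (f s)) \<noteq> 0"
proof -
  let ?v = "\<lambda>i. vec k (M i)"
  let ?a = "\<lambda>s i. c s i \<cdot>\<^sub>v ?v i"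
  have "mat\<^sub>r k k (\<lambda>s. finsum_vec TYPE('b) k (?a s) {..<n}) = mat k k (\<lambda>(s, r). \<Sum>i<n. c s i * M i r)"
    by (intro eq_matI) (auto simp: mat_of_rows_def index_finsum_vec)
  then have "det (mat\<^sub>r k k (\<lambda>s. finsum_vec TYPE('b) k (?a s) {..<n})) \<noteq> 0"
    using assms by (simp add: detk_eq_det)
  moreover have "det (mat\<^sub>r k k (\<lambda>s. finsum_vec TYPE('b) k (?a s) {..<n})) =
      (\<Sum>f | (\<forall>i\<in>{0..<k}. f i \<in> {..<n}) \<and> (\<forall>i. i \<notin> {0..<k} \<longrightarrow> f i = i).
        det (mat\<^sub>r k k (\<lambda>s. ?a s (f s))))"
    by (rule det_linear_rows_sum) auto
  ultimately have "(\<Sum>f | (\<forall>i\<in>{0..<k}. f i \<in> {..<n}) \<and> (\<forall>i. i \<notin> {0..<k} \<longrightarrow> f i = i).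
        det (mat\<^sub>r k k (\<lambda>s. ?a s (f s)))) \<noteq> 0"
    by simp
  then obtain f where f: "\<forall>i\<in>{0..<k}. f i \<in> {..<n}"
      "det (mat\<^sub>r k k (\<lambda>s. ?a s (f s))) \<noteq> 0"
    by (elim sum.not_neutral_contains_not_neutral) blast
  have "det (mat\<^sub>r k k (\<lambda>s. ?a s (f s))) =
      (\<Prod>s = 0..<k. c s (f s)) * det (mat\<^sub>r k k (\<lambda>s. ?v (f s)))"
    by (rule det_rows_mul) auto
  moreover have "mat\<^sub>r k k (\<lambda>s. ?v (f s)) = mat k k (\<lambda>(s, r). M (f s) r)"
    by (intro eq_matI) auto
  ultimately have "detk k (\<lambda>s. M (f s)) \<noteq> 0" using f(2) by (auto simp: detk_eq_det)
  with f(1) show ?thesis by (intro exI[of _ f]) simp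
qed

text \<open>The product of \<open>B\<close> with its right inverse has determinant 1, so some choice
  \<open>f\<close> of columns gives a nonzero determinant. Repeated columns are excluded, and
  sorting them changes only the sign.\<close>

lemma exists_nonzero_minor:
  fixes B :: "nat \<Rightarrow> nat \<Rightarrow> 'b::comm_ring_1"
  assumes inv: "\<And>r s. r < k \<Longrightarrow> s < k \<Longrightarrow> (\<Sum>i<n. B r i * A i s) = (if r = s then 1 else 0)"
  shows "\<exists>s. strict_mono_on {..<k} s \<and> s ` {..<k} \<subseteq> {..<n} \<and> detk k (\<lambda>i j. B i (s j)) \<noteq> 0"
proof -
  have "mat k k (\<lambda>(s, r). \<Sum>i<n. A i s * B r i) = 1\<^sub>m k"
    using inv by (intro eq_matI) (auto simp: mult.commute)
  then have "detk k (\<lambda>s r. \<Sum>i<n. A i s * B r i) \<noteq> 0" by (simp add: detk_eq_det)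
  then obtain f where f: "\<forall>s<k. f s < n" "detk k (\<lambda>s r. B r (f s)) \<noteq> 0"
    using detk_rows_sum_nonzero[of k "\<lambda>s i. A i s" "\<lambda>i r. B r i" n] by blast
  have inj: "inj_on f {..<k}"
  proof (rule inj_onI, rule ccontr)
    fix i j assume "i \<in> {..<k}" "j \<in> {..<k}" "f i = f j" "i \<noteq> j"
    then show False using detk_identical_rows[of i k j "\<lambda>s r. B r (f s)"] f(2) by auto
  qed
  obtain h where h: "bij_betw h {..<card (f ` {..<k})} (f ` {..<k})"
      "strict_mono_on {..<card (f ` {..<k})} h"
    by (rule ex_bij_betw_strict_mono_card[of "f ` {..<k}"]) auto
  have card: "card (f ` {..<k}) = k" using card_image[OF inj] by simp
  \<comment> \<open>\<open>h\<close> lists the chosen columns in increasing order, and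
    \<open>p\<close> is the permutation with \<open>f i = h (p i)\<close> below
    \<open>k\<close>.\<close>
  define p where "p i = (if i < k then inv_into {..<k} h (f i) else i)" for i
  have hp: "h (p i) = f i" if "i < k" for i
    using h that by (simp add: p_def card bij_betw_def f_inv_into_f)
  have "bij_betw (inv_into {..<k} h \<circ> f) {..<k} {..<k}"
    using bij_betw_trans[OF inj_on_imp_bij_betw[OF inj] bij_betw_inv_into[OF h(1)]] by (simp add: card)
  then have "bij_betw p {..<k} {..<k}"
    by (rule bij_betw_cong[THEN iffD1, rotated]) (simp add: p_def)
  then have p: "p permutes {..<k}" by (rule bij_imp_permutes) (simp add: p_def)
  have "detk k (\<lambda>s r. B r (f s)) = detk k (\<lambda>s r. B r (h (p s)))"
    unfolding detk_def using hp by (intro sum.cong arg_cong2[of _ _ _ _ "(*)"] prod.cong) auto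
  also have "\<dots> = of_int (sign p) * detk k (\<lambda>s r. B r (h s))"
    using detk_permute_rows[OF p, of "\<lambda>s r. B r (h s)"] by simp
  finally have "detk k (\<lambda>s r. B r (h s)) \<noteq> 0" using f(2) by auto
  then have "detk k (\<lambda>i j. B i (h j)) \<noteq> 0"
    using detk_transpose[of k "\<lambda>i j. B i (h j)"] by simp
  moreover have "h ` {..<k} \<subseteq> {..<n}" using h(1) f(1) by (auto simp: card bij_betw_def)
  ultimately show ?thesis using h(2) by (auto simp: card)
qed

section \<open>Degrees of minors and minimality\<close>

lemma coeff_prod_degree_bound:
  fixes f :: "'i \<Rightarrow> 'b::comm_ring_1 poly"
  assumes "finite I" "\<And>i. i \<in> I \<Longrightarrow> degree (f i) \<le> d i"
  shows "degree (\<Prod>i\<in>I. f i) \<le> (\<Sum>i\<in>I. d i)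
    \<and> coeff (\<Prod>i\<in>I. f i) (\<Sum>i\<in>I. d i) = (\<Prod>i\<in>I. coeff (f i) (d i))"
  using assms
proof (induction rule: finite_induct)
  case (insert i I)
  let ?P = "\<Prod>i\<in>I. f i" and ?D = "\<Sum>i\<in>I. d i"
  have IH: "degree ?P \<le> ?D" "coeff ?P ?D = (\<Prod>i\<in>I. coeff (f i) (d i))" and di: "degree (f i) \<le> d i"
    using insert by auto
  have "coeff (f i * ?P) (d i + ?D) = (\<Sum>l\<le>d i + ?D. coeff (f i) l * coeff ?P (d i + ?D - l))"
    by (rule coeff_mult)
  also have "\<dots> = (\<Sum>l\<le>d i + ?D. if l = d i then coeff (f i) (d i) * coeff ?P ?D else 0)"
  proof (rule sum.cong)
    fix l assume "l \<in> {..d i + ?D}"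
    consider "l = d i" | "l > d i" | "l < d i" by linarith
    then show "coeff (f i) l * coeff ?P (d i + ?D - l)
        = (if l = d i then coeff (f i) (d i) * coeff ?P ?D else 0)"
    proof cases
      case 2
      then show ?thesis using di by (simp add: coeff_eq_0)
    next
      case 3
      then have "coeff ?P (d i + ?D - l) = 0" using IH(1) by (intro coeff_eq_0) simp
      with 3 show ?thesis by simp
    qed simp
  qed simp
  also have "\<dots> = coeff (f i) (d i) * coeff ?P ?D" by simp
  finally have "coeff (f i * ?P) (d i + ?D) = coeff (f i) (d i) * coeff ?P ?D" .
  moreover have "degree (f i * ?P) \<le> d i + ?D"
    using degree_mult_le[of "f i" ?P] IH(1) di by simp
  ultimately show ?case using insert.hyps IH(2) by simp
qed simp

lemma detk_degree_bound:
  fixes M :: "nat \<Rightarrow> nat \<Rightarrow> 'b::comm_ring_1 poly"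
  assumes deg: "\<And>i j. i < k \<Longrightarrow> j < k \<Longrightarrow> degree (M i j) \<le> d i"
  shows "degree (detk k M) \<le> (\<Sum>i<k. d i)"
    and "coeff (detk k M) (\<Sum>i<k. d i) = detk k (\<lambda>i j. coeff (M i j) (d i))"
proof -
  have b: "degree (\<Prod>i<k. M i (p i)) \<le> (\<Sum>i<k. d i)
      \<and> coeff (\<Prod>i<k. M i (p i)) (\<Sum>i<k. d i) = (\<Prod>i<k. coeff (M i (p i)) (d i))"
    if "p permutes {..<k}" for p
    using permutes_in_image[OF that] deg by (intro coeff_prod_degree_bound) auto
  have of_int_eq: "of_int z * q = smult (of_int z) q" for z and q :: "'b poly"
    by (simp add: of_int_poly)
  show "degree (detk k M) \<le> (\<Sum>i<k. d i)"
    unfolding detk_def of_int_eq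
    by (intro degree_sum_le) (auto intro: order_trans[OF degree_smult_le] simp: b finite_permutations)
  show "coeff (detk k M) (\<Sum>i<k. d i) = detk k (\<lambda>i j. coeff (M i j) (d i))"
    unfolding detk_def of_int_eq coeff_sum by (intro sum.cong) (simp_all add: b)
qed

text \<open>Every maximal minor has degree at most the sum of the row degrees. Its coefficient there
  is the minor of the leading row coefficients, so one nonzero such minor makes the bound
  sharp.\<close>

lemma minimal_encoderI:
  fixes G :: "nat \<Rightarrow> nat \<Rightarrow> 'b::comm_ring_1 poly"
  assumes deg: "\<And>i j. i < k \<Longrightarrow> j < n \<Longrightarrow> degree (G i j) \<le> row_degree n G i"
    and minor: "strict_mono_on {..<k} s" "s ` {..<k} \<subseteq> {..<n}"
      "detk k (\<lambda>i j. coeff (G i (s j)) (row_degree n G i)) \<noteq> 0"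
  shows "minimal_encoder n k G"
proof -
  let ?S = "{degree (detk k (\<lambda>i j. G i (s j))) | s. strict_mono_on {..<k} s \<and> s ` {..<k} \<subseteq> {..<n}}"
  let ?D = "\<Sum>i<k. row_degree n G i"
  have bound: "degree (detk k (\<lambda>i j. G i (s j))) \<le> ?D" if "s ` {..<k} \<subseteq> {..<n}" for s
    using that deg by (intro detk_degree_bound(1)) auto
  then have "?S \<subseteq> {..?D}" by auto
  then have fin: "finite ?S" using finite_subset by blast
  have "coeff (detk k (\<lambda>i j. G i (s j))) ?D = detk k (\<lambda>i j. coeff (G i (s j)) (row_degree n G i))"
    using minor(2) deg by (intro detk_degree_bound(2)) auto
  then have "?D \<le> degree (detk k (\<lambda>i j. G i (s j)))"
    using minor(3) by (intro le_degree) simp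
  then have "degree (detk k (\<lambda>i j. G i (s j))) = ?D" using bound[OF minor(2)] by simp
  then have "?D \<in> ?S" using minor(1,2) by (metis (mono_tags, lifting) mem_Collect_eq)
  then have "Max ?S = ?D" using fin \<open>?S \<subseteq> {..?D}\<close> by (intro Max_eqI) auto
  then show ?thesis by (simp add: minimal_encoder_def max_minor_degree_def)
qed

section \<open>Left ideals from homogeneous rows\<close>

lemma sigmaA_funpow:
  assumes "i < n"
  shows "(sigmaA n ^^ j) a i = a ((i + j * (n - 1)) mod n)"
  using assms
proof (induction j arbitrary: i)
  case (Suc j)
  have "(sigmaA n ^^ Suc j) a i = (sigmaA n ^^ j) a ((i + n - 1) mod n)"
    using Suc.prems by (simp add: sigmaA_def)
  also have "\<dots> = a (((i + n - 1) mod n + j * (n - 1)) mod n)"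
    using Suc.prems by (intro Suc.IH) simp
  \<comment> \<open>Here \<open>n - 1\<close> plays the role of -1 modulo \<open>n\<close>, avoiding
    truncated subtraction.\<close>
  also have "((i + n - 1) mod n + j * (n - 1)) mod n = (i + Suc j * (n - 1)) mod n"
  proof -
    have "i + n - 1 + j * (n - 1) = i + Suc j * (n - 1)" using Suc.prems by simp
    then show ?thesis by (metis mod_add_left_eq)
  qed
  finally show ?case .
qed simp

text \<open>Both sides run over exponents with total \<open>m\<close>; this regrouping is the
  associativity of a triple product.\<close>

lemma sum_triples:
  fixes F :: "nat \<Rightarrow> nat \<Rightarrow> nat \<Rightarrow> 'b::comm_monoid_add"
  shows "(\<Sum>j\<le>m. \<Sum>l\<le>j. F (m - j) l (j - l)) = (\<Sum>q\<le>m. \<Sum>l\<le>q. F (q - l) l (m - q))"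
proof -
  have "(\<Sum>(j, l)\<in>(SIGMA j:{..m}. {..j}). F (m - j) l (j - l))
      = (\<Sum>(q, l)\<in>(SIGMA q:{..m}. {..q}). F (q - l) l (m - q))"
    by (rule sum.reindex_bij_witness[of _ "\<lambda>(q, l). (m - q + l, l)" "\<lambda>(j, l). (m - j + l, l)"]) auto
  then show ?thesis by (simp add: sum.Sigma)
qed

text \<open>Left multiplication by \<open>A\<close> splits a skew polynomial into the components with constant
  \<open>l - m\<close> modulo \<open>n\<close>, where \<open>z\<^sup>m\<close> occurs in position \<open>l\<close>; hence homogeneous
  generators span a left ideal.\<close>
lemma left_ideal_homogeneous:
  fixes H :: "nat \<Rightarrow> nat \<Rightarrow> 'b::comm_ring_1 poly"
  assumes hom: "\<And>r l m. r < k \<Longrightarrow> l < n \<Longrightarrow> coeff (H r l) m \<noteq> 0 \<Longrightarrow> l = (x r + m) mod n"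
  shows "left_ideal n (range (\<lambda>u m l. if l < n then coeff (\<Sum>r<k. u r * H r l) m else 0))"
    (is "left_ideal n (range ?f)")
  unfolding left_ideal_def
proof (intro conjI ballI)
  show "range ?f \<subseteq> skew_polys n"
  proof
    fix f assume "f \<in> range ?f"
    then obtain u where f: "f = ?f u" by blast
    let ?N = "\<Sum>l<n. degree (\<Sum>r<k. u r * H r l)"
    have "f m = (\<lambda>_. 0)" if "m > ?N" for m
    proof
      fix l
      show "f m l = 0"
      proof (cases "l < n")
        case True
        then have "degree (\<Sum>r<k. u r * H r l) \<le> ?N"
          by (intro member_le_sum[where f = "\<lambda>l. degree (\<Sum>r<k. u r * H r l)"]) simp_all
        then have "coeff (\<Sum>r<k. u r * H r l) m = 0"
          using that by (intro coeff_eq_0) (rule le_less_trans)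
        then show ?thesis by (simp add: f)
      qed (simp add: f)
    qed
    then have "{m. f m \<noteq> (\<lambda>_. 0)} \<subseteq> {..?N}" by (auto simp: not_less[symmetric])
    then have "finite {m. f m \<noteq> (\<lambda>_. 0)}" using finite_subset by blast
    then show "f \<in> skew_polys n" by (auto simp: skew_polys_def Aset_def f)
  qed
  show "(\<lambda>_ _. 0) \<in> range ?f" by (rule range_eqI[of _ ?f "\<lambda>_. 0"]) (intro ext, simp)
next
  fix f g assume "f \<in> range ?f" "g \<in> range ?f"
  then obtain u v where "f = ?f u" "g = ?f v" by blast
  then have "skew_add f g = ?f (\<lambda>r. u r + v r)"
    by (intro ext) (simp add: skew_add_def distrib_right sum.distrib)
  then show "skew_add f g \<in> range ?f" by (rule range_eqI[of _ ?f])
next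
  fix p f :: "nat \<Rightarrow> nat \<Rightarrow> 'b"
  assume p: "p \<in> skew_polys n" and "f \<in> range ?f"
  then obtain u where f: "f = ?f u" by blast
  \<comment> \<open>The coefficients of the new multiplier of row \<open>r\<close>: those of
    \<open>p\<close> are read at position \<open>x r - l\<close> modulo \<open>n\<close>. They
    vanish beyond \<open>N + degree (u r)\<close>, so \<open>u'\<close> below is polynomial.\<close>
  define h where "h r m = (\<Sum>l\<le>m. p (m - l) ((x r + l * (n - 1)) mod n) * coeff (u r) l)" for r m
  obtain N where N: "\<And>m. m > N \<Longrightarrow> p m = (\<lambda>_. 0)"
    using p unfolding skew_polys_def finite_nat_set_iff_bounded_le by (auto simp: not_less[symmetric])
  define u' where "u' r = (\<Sum>m\<le>N + degree (u r). monom (h r m) m)" for r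
  have u': "coeff (u' r) m = h r m" for r m
  proof (cases "m \<le> N + degree (u r)")
    case True
    then show ?thesis by (simp add: u'_def coeff_sum)
  next
    case False
    have "p (m - l) i * coeff (u r) l = 0" for l i
    proof (cases "l \<le> degree (u r)")
      case True
      then have "m - l > N" using False by simp
      then show ?thesis by (simp add: N)
    qed (simp add: coeff_eq_0)
    then have "h r m = 0" by (simp add: h_def)
    with False show ?thesis by (simp add: u'_def coeff_sum)
  qed
  have "skew_mult n p f m i = ?f u' m i" for m i
  proof (cases "i < n")
    case False
    then show ?thesis by (simp add: skew_mult_def f)
  next
    case i: True
    define F where "F r a l b = p a ((x r + l * (n - 1)) mod n) * coeff (u r) l * coeff (H r i) b"
      for r a l b
    \<comment> \<open>With \<open>d = j - l\<close>, homogeneity gives \<open>i = x r + d\<close>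
      modulo \<open>n\<close>; shifting back by \<open>j\<close> leaves \<open>x r - l\<close>,
      independent of \<open>d\<close>.\<close>
    have shift: "p (m - j) ((i + j * (n - 1)) mod n) * (coeff (u r) l * coeff (H r i) (j - l))
        = F r (m - j) l (j - l)" if "r < k" "l \<le> j" for r j l
    proof (cases "coeff (H r i) (j - l) = 0")
      case False
      define d where "d = j - l"
      have "i = (x r + d) mod n" using hom[OF that(1) i False] by (simp add: d_def)
      then have "(i + j * (n - 1)) mod n = (x r + d + j * (n - 1)) mod n"
        by (simp add: mod_add_left_eq)
      also have "x r + d + j * (n - 1) = x r + l * (n - 1) + d * n"
      proof -
        obtain n' where "n = Suc n'" using i by (cases n) auto
        moreover have "j = l + d" using that by (simp add: d_def)
        ultimately show ?thesis by (simp add: algebra_simps)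
      qed
      finally show ?thesis by (simp add: F_def mult.assoc)
    qed (simp add: F_def)
    have "skew_mult n p f m i
        = (\<Sum>j\<le>m. p (m - j) ((i + j * (n - 1)) mod n) * coeff (\<Sum>r<k. u r * H r i) j)"
      using i by (simp add: skew_mult_def f sigmaA_funpow)
    also have "\<dots> = (\<Sum>j\<le>m. \<Sum>r<k. \<Sum>l\<le>j. F r (m - j) l (j - l))"
      unfolding coeff_sum coeff_mult sum_distrib_left using shift by (intro sum.cong) auto
    also have "\<dots> = (\<Sum>r<k. \<Sum>j\<le>m. \<Sum>l\<le>j. F r (m - j) l (j - l))" by (rule sum.swap)
    also have "\<dots> = (\<Sum>r<k. \<Sum>q\<le>m. \<Sum>l\<le>q. F r (q - l) l (m - q))"
      by (simp only: sum_triples)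
    also have "\<dots> = coeff (\<Sum>r<k. u' r * H r i) m"
      unfolding coeff_sum coeff_mult u' h_def sum_distrib_right F_def ..
    finally show ?thesis using i by simp
  qed
  then show "skew_mult n p f \<in> range ?f" by (intro range_eqI[of _ ?f u'] ext)
qed

section \<open>Coordinates given by \<phi> and evaluation in the algebraic closure\<close>

lemma is_phi_bases:
  fixes \<phi> :: "'b::field poly \<Rightarrow> nat \<Rightarrow> 'b"
  assumes "is_phi n \<phi>" "n > 0"
  obtains a b where "\<And>g l. \<phi> (\<Sum>i<n. monom (g i) i) l = (\<Sum>i<n. g i * a i l)"
    and "\<And>i l. n \<le> l \<Longrightarrow> a i l = 0"
    and "\<And>j l. j < n \<Longrightarrow> l < n \<Longrightarrow> (\<Sum>i<n. b j i * a i l) = (if j = l then 1 else 0)"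
proof -
  have A: "\<phi> p \<in> Aset n" and add: "\<phi> (p + q) i = \<phi> p i + \<phi> q i"
    and scale: "\<phi> (smult c p) i = c * \<phi> p i"
    and ker: "\<phi> p = (\<lambda>_. 0) \<longleftrightarrow> (monom 1 n - 1) dvd p" and onto: "\<phi> ` UNIV = Aset n"
    for p q c i
    using assms(1) by (simp_all add: is_phi_def)
  define a where "a i = \<phi> (monom 1 i)" for i
  have zero: "\<phi> 0 i = 0" for i using scale[of 0 0 i] by simp
  have sum: "\<phi> (\<Sum>i\<in>I. f i) l = (\<Sum>i\<in>I. \<phi> (f i) l)" if "finite I" for I :: "nat set" and f l
    using that by (induction rule: finite_induct) (simp_all add: zero add)
  have monom: "\<phi> (monom c i) l = c * a i l" for c i l
    using scale[of c "monom 1 i" l] by (simp add: smult_monom a_def)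
  have eval: "\<phi> (\<Sum>i<n. monom (g i) i) l = (\<Sum>i<n. g i * a i l)" for g l
    by (simp add: sum monom)
  have "\<exists>g. \<forall>l<n. (\<Sum>i<n. g i * a i l) = (if j = l then 1 else 0)" if j: "j < n" for j
  proof -
    have "(\<lambda>l. if j = l then 1 else 0) \<in> Aset n" using j by (simp add: Aset_def)
    then obtain p where p: "\<phi> p = (\<lambda>l. if j = l then 1 else 0)" using onto by (metis imageE)
    \<comment> \<open>\<open>eval\<close> covers only degrees below \<open>n\<close>, so the
      preimage \<open>p\<close> of a unit vector is reduced modulo \<open>M\<close>, which keeps its
      image because multiples of \<open>M\<close> map to zero.\<close>
    define M where "M = (monom 1 n - 1 :: 'b poly)"
    have coeffM: "coeff M n = 1" using assms(2) by (simp add: M_def)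
    then have "M \<noteq> 0" by auto
    have degM: "degree M \<le> n" unfolding M_def by (intro degree_diff_le) (simp_all add: degree_monom_le)
    have "degree (p mod M) \<le> n - 1"
      using degree_mod_less'[OF \<open>M \<noteq> 0\<close>, of p] degM by (cases "p mod M = 0") auto
    then have "(\<Sum>i\<le>n - 1. monom (coeff (p mod M) i) i) = p mod M" by (rule poly_as_sum_of_monoms')
    moreover have "{..n - 1} = {..<n}" using assms(2) by auto
    ultimately have pm: "(\<Sum>i<n. monom (coeff (p mod M) i) i) = p mod M" by simp
    have "\<phi> (p div M * M) = (\<lambda>_. 0)" using ker by (simp add: M_def)
    then have "\<phi> p l = \<phi> (p mod M) l" for l
      using add[of "p div M * M" "p mod M" l] by simp
    then have "(\<Sum>i<n. coeff (p mod M) i * a i l) = (if j = l then 1 else 0)" for l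
      using eval[of "coeff (p mod M)" l] p by (simp add: pm)
    then show ?thesis by blast
  qed
  then obtain b where "\<And>j l. j < n \<Longrightarrow> l < n \<Longrightarrow> (\<Sum>i<n. b j i * a i l) = (if j = l then 1 else 0)"
    by metis
  moreover have "a i l = 0" if "n \<le> l" for i l using A that by (simp add: Aset_def a_def)
  ultimately show ?thesis using eval that by blast
qed

lemma map_poly_to_ac_add: "map_poly to_ac (p + q) = map_poly to_ac p + map_poly to_ac q"
  by (intro poly_eqI) (simp add: coeff_map_poly)

lemma poly_map_poly_to_ac_lincomb:
  "poly (map_poly to_ac (\<Sum>i<(n::nat). smult (c i) (p i))) t
    = (\<Sum>i<n. to_ac (c i) * poly (map_poly to_ac (p i)) t)"
proof (induction n)
  case (Suc n)
  have "map_poly to_ac (smult (c n) (p n)) = smult (to_ac (c n)) (map_poly to_ac (p n))"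
    by (intro poly_eqI) (simp add: coeff_map_poly)
  with Suc show ?case by (simp add: map_poly_to_ac_add)
qed simp

section \<open>The polynomial rows and their leading coefficients\<close>

context shift_pattern
begin

lemma end_pos_less: "r < k \<Longrightarrow> end_pos r < n"
  using x_less[of r] by (simp add: end_pos_def)

definition row :: "nat \<Rightarrow> nat \<Rightarrow> 'b::comm_semiring_1 poly" where
  "row = entry (monom 1 1)"

lemma poly_row: "poly (map_poly to_ac (row r j)) t = entry t r j"
  by (auto simp: row_def entry_def map_poly_to_ac_add map_poly_monom poly_monom monom_power map_poly_1')

lemma coeff_row:
  "coeff (row r j) m =
     (if j = x r \<and> m = 0 then 1 else 0)
   + (if \<nu> r > 0 \<and> j = end_pos r \<and> m = \<nu> r then 1 else 0)
   + (if r \<in> tops \<and> j = link r \<and> m = link r - x r then 1 else 0)"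
  by (simp add: row_def entry_def monom_power)

lemma coeff_row_homogeneous:
  assumes "r < k" "coeff (row r j) m \<noteq> 0"
  shows "j = (x r + m) mod n"
proof -
  consider "j = x r" "m = 0" | "j = end_pos r" "m = \<nu> r" | "j = link r" "m = link r - x r"
    using assms(2) unfolding coeff_row by (auto split: if_splits)
  then show ?thesis
  proof cases
    case 1
    with x_less[OF assms(1)] show ?thesis by simp
  next
    case 2
    then show ?thesis by (simp add: end_pos_def)
  next
    case 3
    then show ?thesis using x_less_link[OF assms(1)] link_le[of r] x_less[OF assms(1)] by simp
  qed
qed

lemma degree_row:
  "degree (row r j) \<le> \<nu> r"
proof (rule degree_le, intro allI impI)
  fix m assume "m > \<nu> r"
  then show "coeff (row r j) m = 0"
    using link_less[of r] by (auto simp: coeff_row)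
qed

text \<open>By \<open>link_less\<close> the link term has degree below \<open>\<nu> r\<close>, so
  only the end term counts. For \<open>\<nu> r = 0\<close> the start term takes its place, at the
  same position, and there is no link.\<close>

lemma lead_coeff_row:
  assumes "r < k"
  shows "coeff (row r j) (\<nu> r) = (if j = end_pos r then 1 else 0)"
proof (cases "\<nu> r = 0")
  case True
  then have "end_pos r = x r" using x_less[OF assms] by (simp add: end_pos_def)
  moreover have "r \<notin> tops" using tops_succ(1) True by fastforce
  ultimately show ?thesis using True by (simp add: coeff_row)
next
  case False
  then show ?thesis using link_less[of r] by (auto simp: coeff_row)
qed

lemma inj_on_end_pos: "inj_on end_pos {..<k}"
  using inj_end_pos by (simp add: end_pos_def[abs_def])

end

section \<open>Construction of the code\<close>

theorem theorem4p10:
  fixes \<phi> :: "'a::{finite,field} poly \<Rightarrow> nat \<Rightarrow> 'a"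
    and n k :: nat and \<nu> :: "nat \<Rightarrow> nat"
  assumes "n \<ge> 2" and "n dvd card (UNIV :: 'a set) - 1" and "is_phi n \<phi>"
    and "1 \<le> k" and "2 * k \<le> n + 1"
  shows "\<exists>G :: nat \<Rightarrow> nat \<Rightarrow> 'a poly.
           basic n k G \<and> minimal_encoder n k G
         \<and> (\<forall>i<k. row_degree n G i = \<nu> i)
         \<and> sigma_cyclic n \<phi> (code n k G)"
proof -
  have "k < n" using assms by linarith
  then obtain x where "\<forall>r<k. x r < n - 1" "inj_on x {..<k}"
      "inj_on (\<lambda>r. (x r + \<nu> r) mod n) {..<k}"
    using exists_distinct_shifts_avoiding_last assms(5) by blast
  then interpret shift_pattern n k x \<nu> by unfold_locales auto
  have "n > 0" using assms by simp
  obtain a b where eval: "\<And>g l. \<phi> (\<Sum>i<n. monom (g i) i) l = (\<Sum>i<n. g i * a i l)"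
    and a0: "\<And>i l. n \<le> l \<Longrightarrow> a i l = 0"
    and ba: "\<And>j l. j < n \<Longrightarrow> l < n \<Longrightarrow> (\<Sum>i<n. b j i * a i l) = (if j = l then 1 else 0)"
    using is_phi_bases[OF assms(3) \<open>n > 0\<close>] by blast
  \<comment> \<open>The rows live in the coordinates of \<open>A\<close>; the constant matrix
    \<open>b\<close> takes them back to coordinates in powers of x, and \<open>a\<close> undoes
    this.\<close>
  define G :: "nat \<Rightarrow> nat \<Rightarrow> 'a poly"
    where "G r i = (\<Sum>j<n. smult (b j i) (row r j))" for r i
  have HG: "row r l = (\<Sum>i<n. smult (a i l) (G r i))" if "l < n" for r l
  proof -
    have "coeff (\<Sum>i<n. smult (a i l) (G r i)) m = coeff (row r l) m" for m
    proof -
      have "coeff (\<Sum>i<n. smult (a i l) (G r i)) m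
          = (\<Sum>i<n. \<Sum>j<n. b j i * a i l * coeff (row r j) m)"
        unfolding G_def coeff_sum coeff_smult sum_distrib_left
        by (intro sum.cong refl) (simp add: mult_ac)
      also have "\<dots> = (\<Sum>j<n. (\<Sum>i<n. b j i * a i l) * coeff (row r j) m)"
        unfolding sum_distrib_right by (rule sum.swap)
      also have "\<dots> = (\<Sum>j<n. if j = l then coeff (row r j) m else 0)"
        using ba that by (intro sum.cong) auto
      finally show ?thesis using that by simp
    qed
    then show ?thesis by (intro poly_eqI) simp
  qed
  have degG: "degree (G r i) \<le> \<nu> r" for r i
    unfolding G_def
    by (intro degree_sum_le) (auto intro: order_trans[OF degree_smult_le] degree_row)
  have leadG: "coeff (G r i) (\<nu> r) = b (end_pos r) i" if "r < k" for r i
  proof -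
    have "coeff (G r i) (\<nu> r) = (\<Sum>j<n. if j = end_pos r then b j i else 0)"
      unfolding G_def coeff_sum by (intro sum.cong) (simp_all add: lead_coeff_row that)
    with end_pos_less[OF that] show ?thesis by simp
  qed
  have rd: "row_degree n G r = \<nu> r" if r: "r < k" for r
  proof -
    have "\<exists>i<n. b (end_pos r) i \<noteq> 0"
    proof (rule ccontr)
      assume "\<not> ?thesis"
      with ba[OF end_pos_less[OF r] end_pos_less[OF r]] show False by simp
    qed
    then obtain i where i: "i < n" "b (end_pos r) i \<noteq> 0" by blast
    then have "\<nu> r \<le> degree (G r i)" using leadG[OF r, of i] by (intro le_degree) simp
    then have "\<nu> r = degree (G r i)" using degG[of r i] by simp
    then show ?thesis
      unfolding row_degree_def
    proof (intro Max_eqI)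
      show "\<nu> r \<in> {degree (G r j) | j. j < n}" using i(1) \<open>\<nu> r = degree (G r i)\<close> by blast
      show "d \<le> \<nu> r" if "d \<in> {degree (G r j) | j. j < n}" for d using that degG by blast
    qed simp
  qed
  have "basic n k G"
    unfolding basic_def
  proof (intro allI impI)
    fix t :: "'a alg_closure" and c s
    assume c: "\<forall>j<n. (\<Sum>i<k. c i * poly (map_poly to_ac (G i j)) t) = 0" and s: "s < k"
    \<comment> \<open>Multiplication by \<open>a\<close> turns a relation between the rows of
      \<open>G\<close> at \<open>t\<close> into one between the homogeneous rows.\<close>
    have "(\<Sum>r<k. c r * entry t r l) = 0" if l: "l < n" for l
    proof -
      have "(\<Sum>r<k. c r * entry t r l) = (\<Sum>r<k. c r * poly (map_poly to_ac (row r l)) t)"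
        by (simp only: poly_row)
      also have "\<dots> = (\<Sum>r<k. \<Sum>i<n. to_ac (a i l) * (c r * poly (map_poly to_ac (G r i)) t))"
        unfolding HG[OF l] poly_map_poly_to_ac_lincomb sum_distrib_left
        by (simp only: mult.left_commute)
      also have "\<dots> = (\<Sum>i<n. to_ac (a i l) * (\<Sum>r<k. c r * poly (map_poly to_ac (G r i)) t))"
        unfolding sum_distrib_left by (rule sum.swap)
      also have "\<dots> = 0" using c by simp
      finally show ?thesis .
    qed
    then show "c s = 0" using s by (rule independent_rows)
  qed
  moreover have "minimal_encoder n k G"
  proof -
    \<comment> \<open>The leading coefficients of \<open>G\<close> are the rows of \<open>b\<close>
      at the end positions; as these are distinct, the matching columns of \<open>a\<close> form a
      right inverse.\<close>
    have "(\<Sum>i<n. b (end_pos r) i * a i (end_pos s)) = (if r = s then 1 else 0)" if "r < k" "s < k" for r s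
      using ba[OF end_pos_less end_pos_less] inj_on_end_pos that by (simp add: inj_on_eq_iff)
    then obtain s where s: "strict_mono_on {..<k} s" "s ` {..<k} \<subseteq> {..<n}"
        "detk k (\<lambda>i j. b (end_pos i) (s j)) \<noteq> 0"
      using exists_nonzero_minor[of k "\<lambda>r. b (end_pos r)" "\<lambda>i s. a i (end_pos s)" n] by blast
    have "detk k (\<lambda>i j. coeff (G i (s j)) (row_degree n G i)) = detk k (\<lambda>i j. b (end_pos i) (s j))"
      unfolding detk_def by (intro sum.cong arg_cong2[of _ _ _ _ "(*)"] prod.cong) (simp_all add: rd leadG)
    then have "detk k (\<lambda>i j. coeff (G i (s j)) (row_degree n G i)) \<noteq> 0" using s(3) by metis
    with s(1,2) show ?thesis by (rule minimal_encoderI[rotated]) (simp add: rd degG)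
  qed
  moreover have "sigma_cyclic n \<phi> (code n k G)"
  proof -
    let ?f = "\<lambda>u m l. if l < n then coeff (\<Sum>r<k. u r * row r l) m else 0"
    let ?v = "\<lambda>u j. if j < n then (\<Sum>i<k. u i * G i j) else 0"
    have "frak_p n \<phi> (?v u) m l = ?f u m l" for u m l
    proof -
      have eq: "frak_p n \<phi> (?v u) m l = (\<Sum>i<n. coeff (\<Sum>r<k. u r * G r i) m * a i l)"
        unfolding frak_p_def eval by simp
      show ?thesis
      proof (cases "l < n")
        case True
        have "(\<Sum>i<n. coeff (\<Sum>r<k. u r * G r i) m * a i l)
            = coeff (\<Sum>i<n. \<Sum>r<k. u r * smult (a i l) (G r i)) m"
          by (simp add: coeff_sum sum_distrib_left mult.commute)
        also have "(\<Sum>i<n. \<Sum>r<k. u r * smult (a i l) (G r i)) = (\<Sum>r<k. u r * row r l)"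
          unfolding HG[OF True] sum_distrib_left by (rule sum.swap)
        finally show ?thesis using True eq by simp
      qed (simp add: eq a0)
    qed
    then have "(\<lambda>u. frak_p n \<phi> (?v u)) = ?f" by (intro ext)
    moreover have "code n k G = range ?v" by (auto simp: code_def)
    ultimately have "frak_p n \<phi> ` code n k G = range ?f" by (simp only: image_image)
    moreover have "left_ideal n (range ?f)"
      by (rule left_ideal_homogeneous) (use coeff_row_homogeneous in blast)
    ultimately show ?thesis by (simp add: sigma_cyclic_def)
  qed
  ultimately show ?thesis using rd by blast
qed

end
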